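(* Let $X$ be a (real) Fréchet space and let $f,g:X\to\overline{\mathbb R}$ be proper, convex and lower semicontinuous functions with $\operatorname{dom}f\cap\operatorname{dom}g\ne\emptyset$ and $v(P_F)\in\mathbb R$. Consider the conditions: (RC1) there exists $x'\in\operatorname{dom}f\cap\operatorname{dom}g$ such that $f$ (or $g$) is continuous at $x'$; (RC2) $0\in\operatorname{int}(\operatorname{dom}f-\operatorname{dom}g)$; (RC3) $0\in\operatorname{core}(\operatorname{dom}f-\operatorname{dom}g)$; (RC6) $0\in\operatorname{qi}(\operatorname{dom}f-\operatorname{dom}g)$ and $(0,0)\notin\operatorname{qri}[\operatorname{co}(E_F\cup\{(0,0)\})]$; (RC7) $0\in\operatorname{qi}[(\operatorname{dom}f-\operatorname{dom}g)-(\operatorname{dom}f-\operatorname{dom}g)]$, $0\in\operatorname{qri}(\operatorname{dom}f-\operatorname{dom}g)$ and $(0,0)\notin\operatorname{qri}[\operatorname{co}(E_F\cup\{(0,0)\})]$. Then (RC1) $\Rightarrow$ (RC2) $\Leftrightarrow$ (RC3) $\Rightarrow$ (RC6) $\Leftrightarrow$ (RC7).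
   Context: $\overline{\mathbb R}=\mathbb R\cup\{\pm\infty\}$. For $h:X\to\overline{\mathbb R}$: $\operatorname{dom}h=\{x:h(x)<+\infty\}$, $\operatorname{epi}h=\{(x,r)\in X\times\mathbb R:h(x)\le r\}$, $\widehat{\operatorname{epi}}(h)=\{(x,r)\in X\times\mathbb R:(x,-r)\in\operatorname{epi}h\}$; $h$ is proper if $\operatorname{dom}h\neq\emptyset$ and $h>-\infty$ everywhere. $v(P_F)=\inf_{x\in X}\{f(x)+g(x)\}$. $E_F:=\operatorname{epi}f-\widehat{\operatorname{epi}}(g-v(P_F))=\{(x-y,f(x)+g(y)-v(P_F)+\varepsilon):x\in\operatorname{dom}f,\ y\in\operatorname{dom}g,\ \varepsilon\ge0\}$. For a nonempty convex subset $U$ of a separated locally convex space $V$, $\operatorname{cone}(U)=\bigcup_{t\ge0}tU$; $\operatorname{core}(U)=\{u\in U:\operatorname{cone}(U-u)=V\}$; $\operatorname{qi}(U)=\{u\in U:\operatorname{cl}(\operatorname{cone}(U-u))=V\}$; $\operatorname{qri}(U)=\{u\in U:\operatorname{cl}(\operatorname{cone}(U-u))\text{ is a linear subspace of }V\}$. $\operatorname{int}$ is the interior, $\operatorname{co}$ the convex hull, $\operatorname{cl}$ the closure. *)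

theory Defs
  imports "HOL-Analysis.Analysis"
begin

text \<open>
  A real Frechet space: a locally convex topological vector space whose topology is induced by
  a complete translation-invariant metric.  The metric is only required to exist; the Hausdorff
  property follows from metrizability.  Convexity of \<open>V\<close> is written out because the constant
  \<open>convex\<close> cannot be used in a class specification; see \<open>locally_convex_convex\<close> below.
\<close>

class frechet_space = real_vector + topological_ab_group_add +
  assumes tendsto_scaleR_nhds:
    "((\<lambda>p. fst p *\<^sub>R snd p) \<longlongrightarrow> c *\<^sub>R a) (nhds c \<times>\<^sub>F nhds a)"
  and locally_convex_0:
    "open U \<Longrightarrow> 0 \<in> U \<Longrightarrow> \<exists>V. open V \<and> 0 \<in> V \<and> V \<subseteq> U \<and>
       (\<forall>x\<in>V. \<forall>y\<in>V. \<forall>u\<ge>0. \<forall>v\<ge>0. u + v = 1 \<longrightarrow> u *\<^sub>R x + v *\<^sub>R y \<in> V)"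
  and complete_invariant_metric:
    "\<exists>d. Metric_space UNIV d \<and>
         (\<forall>U. openin (Metric_space.mtopology UNIV d) U \<longleftrightarrow> open U) \<and>
         Metric_space.mcomplete UNIV d \<and> (\<forall>x y z. d (x + z) (y + z) = d x y)"

instance frechet_space \<subseteq> t2_space
proof
  fix x y :: 'a
  assume "x \<noteq> y"
  obtain d :: "'a \<Rightarrow> 'a \<Rightarrow> real" where d: "Metric_space UNIV d"
    and op: "\<And>U. openin (Metric_space.mtopology UNIV d) U \<longleftrightarrow> open U"
    using complete_invariant_metric by blast
  show "\<exists>U V. open U \<and> open V \<and> x \<in> U \<and> y \<in> V \<and> U \<inter> V = {}"
    using Metric_space.Hausdorff_space_mtopology[OF d] \<open>x \<noteq> y\<close>
    by (simp add: Hausdorff_space_def op disjnt_def Metric_space.topspace_mtopology[OF d])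
qed

lemma locally_convex_convex:
  fixes U :: "'a::frechet_space set"
  assumes "open U" "0 \<in> U"
  shows "\<exists>V. open V \<and> convex V \<and> 0 \<in> V \<and> V \<subseteq> U"
  using locally_convex_0[OF assms] unfolding convex_def by blast

instance banach \<subseteq> frechet_space
proof
  fix c :: real and a :: 'a
  show "((\<lambda>p. fst p *\<^sub>R snd p) \<longlongrightarrow> c *\<^sub>R a) (nhds c \<times>\<^sub>F nhds a)"
    by (intro tendsto_scaleR filterlim_fst filterlim_snd)
next
  fix U :: "'a set"
  assume "open U" "0 \<in> U"
  then obtain e where "e > 0" "ball 0 e \<subseteq> U"
    using open_contains_ball by blast
  then show "\<exists>V. open V \<and> 0 \<in> V \<and> V \<subseteq> U \<and>
       (\<forall>x\<in>V. \<forall>y\<in>V. \<forall>u\<ge>0. \<forall>v\<ge>0. u + v = 1 \<longrightarrow> u *\<^sub>R x + v *\<^sub>R y \<in> V)"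
    using convex_ball[of "0::'a" e] by (intro exI[of _ "ball 0 e"]) (simp add: convex_def)
next
  show "\<exists>d::'a \<Rightarrow> 'a \<Rightarrow> real. Metric_space UNIV d \<and>
      (\<forall>U. openin (Metric_space.mtopology UNIV d) U \<longleftrightarrow> open U) \<and>
      Metric_space.mcomplete UNIV d \<and> (\<forall>x y z. d (x + z) (y + z) = d x y)"
    by (rule exI[of _ dist])
       (auto simp: Met_TC.Metric_space_axioms mcomplete_iff_complete complete_UNIV)
qed


section \<open>Extended-real-valued functions\<close>

definition edom :: "('a \<Rightarrow> ereal) \<Rightarrow> 'a set" where
  "edom h = {x. h x < \<infinity>}"

definition epi :: "('a \<Rightarrow> ereal) \<Rightarrow> ('a \<times> real) set" where
  "epi h = {(x, r). h x \<le> ereal r}"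

definition epi_hat :: "('a \<Rightarrow> ereal) \<Rightarrow> ('a \<times> real) set" where
  "epi_hat h = {(x, r). (x, - r) \<in> epi h}"

definition proper_fun :: "('a \<Rightarrow> ereal) \<Rightarrow> bool" where
  "proper_fun h \<longleftrightarrow> edom h \<noteq> {} \<and> (\<forall>x. h x > -\<infinity>)"

text \<open>
  Convexity is used for proper functions only, so the right-hand side never involves
  \<open>\<infinity> - \<infinity>\<close>; the weights are strictly positive, so it never involves \<open>0 * \<infinity>\<close>.
\<close>

definition convex_fun :: "('a::real_vector \<Rightarrow> ereal) \<Rightarrow> bool" where
  "convex_fun h \<longleftrightarrow> (\<forall>x y t. 0 < t \<and> t < 1 \<longrightarrow>
     h ((1 - t) *\<^sub>R x + t *\<^sub>R y) \<le> ereal (1 - t) * h x + ereal t * h y)"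

definition lsc_fun :: "('a::topological_space \<Rightarrow> ereal) \<Rightarrow> bool" where
  "lsc_fun h \<longleftrightarrow> (\<forall>x. h x \<le> Liminf (at x) h)"


section \<open>Generalized interiors\<close>

text \<open>The library's \<open>-\<close> on sets is the set-theoretic difference.\<close>

definition minkowski_diff :: "'a::minus set \<Rightarrow> 'a set \<Rightarrow> 'a set" where
  "minkowski_diff A B = {a - b | a b. a \<in> A \<and> b \<in> B}"

definition gen_cone :: "'a::real_vector set \<Rightarrow> 'a set" where
  "gen_cone U = (\<Union>t\<in>{0..}. (\<lambda>x. t *\<^sub>R x) ` U)"

definition core :: "'a::real_vector set \<Rightarrow> 'a set" where
  "core U = {u \<in> U. gen_cone ((\<lambda>x. x - u) ` U) = UNIV}"

definition qi :: "'a::{real_vector, topological_space} set \<Rightarrow> 'a set" where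
  "qi U = {u \<in> U. closure (gen_cone ((\<lambda>x. x - u) ` U)) = UNIV}"

definition qri :: "'a::{real_vector, topological_space} set \<Rightarrow> 'a set" where
  "qri U = {u \<in> U. subspace (closure (gen_cone ((\<lambda>x. x - u) ` U)))}"


section \<open>The primal problem and its regularity conditions\<close>

definition v_PF :: "('a \<Rightarrow> ereal) \<Rightarrow> ('a \<Rightarrow> ereal) \<Rightarrow> ereal" where
  "v_PF f g = (INF x. f x + g x)"

definition E_F :: "('a::real_vector \<Rightarrow> ereal) \<Rightarrow> ('a \<Rightarrow> ereal) \<Rightarrow> ('a \<times> real) set" where
  "E_F f g = minkowski_diff (epi f) (epi_hat (\<lambda>x. g x - v_PF f g))"

lemma E_F_eq:
  assumes f: "proper_fun f" and g: "proper_fun g" and v: "v_PF f g = ereal v"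
  shows "E_F f g = {(x - y, real_of_ereal (f x) + real_of_ereal (g y) - v + e) | x y e.
                     x \<in> edom f \<and> y \<in> edom g \<and> e \<ge> 0}" (is "_ = ?R")
proof (intro set_eqI iffI)
  fix p assume "p \<in> E_F f g"
  then obtain x r y s where p: "p = (x - y, r - s)" and 1: "f x \<le> ereal r"
    and 2: "g y - ereal v \<le> ereal (- s)"
    by (auto simp: E_F_def minkowski_diff_def epi_def epi_hat_def v)
  obtain a where a: "f x = ereal a" using 1 f by (cases "f x") (auto simp: proper_fun_def)
  obtain b where b: "g y = ereal b"
    using 2 g by (cases "g y") (auto simp: proper_fun_def)
  show "p \<in> ?R"
    unfolding mem_Collect_eq
    by (rule exI[of _ x], rule exI[of _ y], rule exI[of _ "r - s - (a + b - v)"])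
       (use 1 2 a b p in \<open>auto simp: edom_def\<close>)
next
  fix p assume "p \<in> ?R"
  then obtain x y e where
    p: "p = (x - y, real_of_ereal (f x) + real_of_ereal (g y) - v + e)"
    and x: "x \<in> edom f" and y: "y \<in> edom g" and e: "e \<ge> 0" by blast
  obtain a where a: "f x = ereal a" using x f by (cases "f x") (auto simp: proper_fun_def edom_def)
  obtain b where b: "g y = ereal b" using y g by (cases "g y") (auto simp: proper_fun_def edom_def)
  have "(x, a + e) \<in> epi f" "(y, v - b) \<in> epi_hat (\<lambda>x. g x - v_PF f g)"
    using a b e v by (auto simp: epi_def epi_hat_def)
  moreover have "p = (x, a + e) - (y, v - b)" using p a b by simp
  ultimately show "p \<in> E_F f g" unfolding E_F_def minkowski_diff_def by blast
qed

definition RC1 :: "('a::t2_space \<Rightarrow> ereal) \<Rightarrow> ('a \<Rightarrow> ereal) \<Rightarrow> bool" where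
  "RC1 f g \<longleftrightarrow> (\<exists>x' \<in> edom f \<inter> edom g. isCont f x' \<or> isCont g x')"

definition RC2 ::
  "('a::{real_vector, topological_space} \<Rightarrow> ereal) \<Rightarrow> ('a \<Rightarrow> ereal) \<Rightarrow> bool" where
  "RC2 f g \<longleftrightarrow> 0 \<in> interior (minkowski_diff (edom f) (edom g))"

definition RC3 :: "('a::real_vector \<Rightarrow> ereal) \<Rightarrow> ('a \<Rightarrow> ereal) \<Rightarrow> bool" where
  "RC3 f g \<longleftrightarrow> 0 \<in> core (minkowski_diff (edom f) (edom g))"

definition RC6 ::
  "('a::{real_vector, topological_space} \<Rightarrow> ereal) \<Rightarrow> ('a \<Rightarrow> ereal) \<Rightarrow> bool" where
  "RC6 f g \<longleftrightarrow> 0 \<in> qi (minkowski_diff (edom f) (edom g)) \<and>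
     (0, 0) \<notin> qri (convex hull (E_F f g \<union> {(0, 0)}))"

definition RC7 ::
  "('a::{real_vector, topological_space} \<Rightarrow> ereal) \<Rightarrow> ('a \<Rightarrow> ereal) \<Rightarrow> bool" where
  "RC7 f g \<longleftrightarrow>
     0 \<in> qi (minkowski_diff (minkowski_diff (edom f) (edom g)) (minkowski_diff (edom f) (edom g))) \<and>
     0 \<in> qri (minkowski_diff (edom f) (edom g)) \<and>
     (0, 0) \<notin> qri (convex hull (E_F f g \<union> {(0, 0)}))"

end

theory Submission
  imports Defs
begin

text \<open>
  Write \<open>D\<close> for the Minkowski difference of the domains of \<open>f\<close> and \<open>g\<close>.

  The substance is that \<open>0 \<in> core D\<close> already gives a neighbourhood of \<open>0\<close> on which the
  perturbation function \<open>y \<mapsto> inf {f x + g z | x - z = y}\<close> is bounded above.  Fix a common domain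
  point \<open>p\<close> and a level \<open>R\<close> above \<open>f p\<close> and \<open>g p\<close>.  The sublevel sets \<open>A\<close> of \<open>f\<close> and \<open>B\<close> of \<open>g\<close>
  at level \<open>R\<close> are closed and convex, and their difference inherits from \<open>D\<close> the property of being
  absorbing, because moving a little from \<open>p\<close> towards any domain point stays below \<open>R\<close>
  (\<open>zero_in_interior_sublevel_diff\<close>).  A difference of two closed convex sets need not be closed,
  but in a Frechet space it is still a neighbourhood of \<open>0\<close> once it is absorbing
  (\<open>absorbing_diff_imp_zero_interior\<close>): Baire's theorem makes closures of localized differences
  neighbourhoods of \<open>0\<close>, and the Banach--Schauder device of halving the error removes the closure by
  completeness.  Since \<open>A - B \<subseteq> D\<close>, the origin is interior to \<open>D\<close>.

  The bound from above also excludes \<open>(0, 0)\<close> from the quasi-relative interior of the hull of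
  \<open>E_F f g\<close> and the origin (\<open>zero_notin_qri_hull\<close>).  Otherwise the closed cone of the hull would be
  a linear subspace; it contains the upward vertical direction, hence the downward one too.  But
  \<open>E_F f g\<close> is in essence the epigraph of the perturbation function shifted to vanish at \<open>0\<close>, and
  a convex function that vanishes at \<open>0\<close> and is bounded above near \<open>0\<close> is also bounded below there;
  the cone therefore has no points near \<open>(0, -1)\<close>.

  The equivalence of the last two conditions holds for any set \<open>S\<close> containing \<open>0\<close>
  (\<open>zero_in_qi_iff\<close>): once the closed cone of \<open>S\<close> is a linear subspace, it contains \<open>S - S\<close> and
  so agrees with the closed cone of \<open>S - S\<close>.
\<close>

section \<open>Scaling and absorbing sets in Frechet spaces\<close>

lemma tendsto_scaleR_frechet:
  fixes a :: "'a::frechet_space"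
  assumes "(s \<longlongrightarrow> c) F" and "(h \<longlongrightarrow> a) F"
  shows "((\<lambda>x. s x *\<^sub>R h x) \<longlongrightarrow> c *\<^sub>R a) F"
  using filterlim_compose[OF tendsto_scaleR_nhds filterlim_Pair[OF assms]] by simp

lemma continuous_on_affine:
  fixes a :: "'a::frechet_space"
  shows "continuous_on S (\<lambda>x. a + c *\<^sub>R x)"
  unfolding continuous_on_def
  by (auto intro!: tendsto_add tendsto_scaleR_frechet tendsto_const tendsto_ident_at)

lemma open_affine_preimage:
  fixes a :: "'a::frechet_space"
  assumes "open U"
  shows "open {x. a + c *\<^sub>R x \<in> U}"
  using open_vimage[OF assms continuous_on_affine] by (simp add: vimage_def)

lemma closed_affine_preimage:
  fixes a :: "'a::frechet_space"
  assumes "closed U"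
  shows "closed {x. a + c *\<^sub>R x \<in> U}"
  using closed_vimage[OF assms continuous_on_affine] by (simp add: vimage_def)

definition absorbing :: "'a::real_vector set \<Rightarrow> bool" where
  "absorbing S \<longleftrightarrow> (\<forall>x. \<exists>t>0. t *\<^sub>R x \<in> S)"

text \<open>
  A multiplier \<open>t > 0\<close> in \<open>x = t *\<^sub>R y\<close> inverts to \<open>1 / t\<close>.  A multiplier \<open>0\<close> occurs only for
  \<open>x = 0\<close>, which belongs to the set itself.
\<close>

lemma zero_in_core_iff_absorbing: "0 \<in> core S \<longleftrightarrow> absorbing S"
proof
  assume c: "0 \<in> core S"
  then have 0: "0 \<in> S" by (simp add: core_def)
  show "absorbing S"
    unfolding absorbing_def
  proof
    fix x
    have "x \<in> gen_cone S" using c by (simp add: core_def)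
    then obtain t y where t: "t \<ge> 0" "y \<in> S" "x = t *\<^sub>R y" by (auto simp: gen_cone_def)
    show "\<exists>t>0. t *\<^sub>R x \<in> S"
    proof (cases "t = 0")
      case True
      then show ?thesis using 0 t by (intro exI[of _ 1]) simp
    next
      case False
      then show ?thesis using t by (intro exI[of _ "1 / t"]) simp
    qed
  qed
next
  assume a: "absorbing S"
  have "0 \<in> S" using a unfolding absorbing_def by (metis scaleR_zero_right)
  moreover have "x \<in> gen_cone S" for x
  proof -
    obtain t where "t > 0" "t *\<^sub>R x \<in> S" using a unfolding absorbing_def by blast
    then show ?thesis
      unfolding gen_cone_def
      by (intro UN_I[of "1 / t"] image_eqI[of _ _ "t *\<^sub>R x"]) auto
  qed
  ultimately show "0 \<in> core S" by (auto simp: core_def)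
qed

lemma eventually_scaled_in_nhd:
  fixes x :: "'a::frechet_space"
  assumes "open U" "0 \<in> U"
  shows "\<forall>\<^sub>F t in at_right (0::real). t *\<^sub>R x \<in> U"
proof -
  have "((\<lambda>t. t *\<^sub>R x) \<longlongrightarrow> 0 *\<^sub>R x) (at_right (0::real))"
    by (intro tendsto_scaleR_frechet tendsto_const tendsto_ident_at)
  then show ?thesis using topological_tendstoD assms by force
qed

lemma absorbing_of_interior:
  fixes S :: "'a::frechet_space set"
  assumes "0 \<in> interior S"
  shows "absorbing S"
  unfolding absorbing_def
proof
  fix x
  have "\<forall>\<^sub>F t in at_right (0::real). t *\<^sub>R x \<in> interior S \<and> t > 0"
    using eventually_scaled_in_nhd[OF open_interior assms]
    by (intro eventually_conj eventually_at_right_less)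
  then obtain t :: real where "t *\<^sub>R x \<in> interior S \<and> t > 0"
    using eventually_happens' trivial_limit_at_right_real by blast
  then show "\<exists>t>0. t *\<^sub>R x \<in> S" using interior_subset by blast
qed

section \<open>Completeness and category\<close>

lemma frechet_metric:
  obtains d :: "'a::frechet_space \<Rightarrow> 'a \<Rightarrow> real"
  where "Metric_space UNIV d" "Metric_space.mtopology UNIV d = euclidean"
    "Metric_space.mcomplete UNIV d" "\<And>x y z. d (x + z) (y + z) = d x y"
proof -
  obtain d :: "'a \<Rightarrow> 'a \<Rightarrow> real" where m: "Metric_space UNIV d"
    and op: "\<And>U. openin (Metric_space.mtopology UNIV d) U \<longleftrightarrow> open U"
    and compl: "Metric_space.mcomplete UNIV d"
    and inv: "\<And>x y z. d (x + z) (y + z) = d x y"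
    using complete_invariant_metric by blast
  have "Metric_space.mtopology UNIV d = euclidean"
    unfolding topology_eq op open_openin[symmetric] by (rule allI, rule refl)
  with m show thesis using compl inv by (rule that)
qed

text \<open>
  What the iteration in \<open>absorbing_diff_imp_zero_interior\<close> needs from the complete metric, freed from the
  metric: a convex neighbourhood base so fast-shrinking that increments taken from successive
  members force convergence.  Member \<open>n\<close> is chosen inside the ball of radius \<open>(1/2)^n\<close>; translation
  invariance turns the smallness of an increment into closeness of successive terms.
\<close>

lemma frechet_convex_base:
  "\<exists>V :: nat \<Rightarrow> 'a::frechet_space set.
     (\<forall>n. open (V n) \<and> convex (V n) \<and> 0 \<in> V n) \<and>
     (\<forall>U. open U \<longrightarrow> 0 \<in> U \<longrightarrow> (\<forall>\<^sub>F n in sequentially. V n \<subseteq> U)) \<and>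
     (\<forall>x. (\<forall>n. x (Suc n) - x n \<in> V n) \<longrightarrow> convergent x)"
proof -
  obtain d :: "'a \<Rightarrow> 'a \<Rightarrow> real" where m: "Metric_space UNIV d"
    and top: "Metric_space.mtopology UNIV d = euclidean"
    and compl: "Metric_space.mcomplete UNIV d"
    and inv: "\<And>x y z. d (x + z) (y + z) = d x y"
    by (rule frechet_metric) (rule that; assumption)
  interpret Metric_space UNIV d by (rule m)
  have op: "openin mtopology U \<longleftrightarrow> open U" for U by (simp add: top)
  have "\<exists>V. open V \<and> convex V \<and> 0 \<in> V \<and> V \<subseteq> mball 0 ((1/2)^n)" for n :: nat
    by (rule locally_convex_convex) (auto simp flip: op)
  then obtain V :: "nat \<Rightarrow> 'a set" where V: "\<And>n. open (V n)" "\<And>n. convex (V n)" "\<And>n. 0 \<in> V n"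
    and Vb: "\<And>n. V n \<subseteq> mball 0 ((1/2)^n)"
    by metis
  have small: "\<forall>\<^sub>F n in sequentially. V n \<subseteq> U" if U: "open U" "0 \<in> U" for U
  proof -
    obtain r where r: "r > 0" "mball 0 r \<subseteq> U"
      using U unfolding op[symmetric] openin_mtopology by blast
    have "(\<lambda>n. (1/2::real)^n) \<longlonglongrightarrow> 0" by (rule LIMSEQ_realpow_zero) auto
    then have "\<forall>\<^sub>F n in sequentially. (1/2)^n < r" using r(1) by (rule order_tendstoD)
    then show ?thesis
      by eventually_elim (use Vb r(2) in fastforce)
  qed
  have conv: "convergent x" if x: "\<And>n. x (Suc n) - x n \<in> V n" for x
  proof -
    have step: "d (x n) (x (Suc n)) < (1/2)^n" for n
      using Vb[of n] x[of n] inv[of 0 "x n" "x (Suc n) - x n"] by (auto simp: commute)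
    have far: "d (x n) (x (n + k)) \<le> 2 * (1/2)^n - 2 * (1/2)^(n + k)" for n k
    proof (induction k)
      case (Suc k)
      have "d (x n) (x (n + Suc k)) \<le> d (x n) (x (n + k)) + d (x (n + k)) (x (n + Suc k))"
        by (rule triangle) auto
      then show ?case using Suc step[of "n + k"] by simp
    qed simp
    have "MCauchy x"
      unfolding MCauchy_def
    proof (intro conjI allI impI)
      fix e :: real assume e: "e > 0"
      have "(\<lambda>n. 4 * (1/2::real)^n) \<longlonglongrightarrow> 4 * 0"
        by (intro tendsto_intros LIMSEQ_realpow_zero) auto
      then have "\<forall>\<^sub>F n in sequentially. 4 * (1/2)^n < e" by (rule order_tendstoD(2)) (use e in simp)
      then obtain N where N: "4 * (1/2)^N < e" by (auto simp: eventually_sequentially)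
      have "d (x N) (x n) < e / 2" if "N \<le> n" for n
      proof -
        have "d (x N) (x n) \<le> 2 * (1/2)^N - 2 * (1/2)^n" using far[of N "n - N"] that by simp
        moreover have "0 < 2 * (1/2::real)^n" by simp
        ultimately show ?thesis using N by linarith
      qed
      then have "d (x N) (x n) + d (x N) (x n') < e" if "N \<le> n" "N \<le> n'" for n n'
        using that by (metis add_strict_mono field_sum_of_halves)
      then have "d (x n) (x n') < e" if "N \<le> n" "N \<le> n'" for n n'
        using that triangle''[of "x n" "x N" "x n'"] by (meson UNIV_I le_less_trans)
      then show "\<exists>N. \<forall>n n'. N \<le> n \<longrightarrow> N \<le> n' \<longrightarrow> d (x n) (x n') < e" by blast
    qed simp
    then show ?thesis
      using compl unfolding mcomplete_def top convergent_def by auto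
  qed
  show ?thesis
    using V small conv by (intro exI[of _ V] conjI allI impI) auto
qed

lemma frechet_Baire:
  fixes T :: "nat \<Rightarrow> 'a::frechet_space set"
  assumes "\<And>n. closed (T n)" and "(\<Union>n. T n) = UNIV"
  shows "\<exists>n. interior (T n) \<noteq> {}"
proof (rule ccontr)
  obtain d :: "'a \<Rightarrow> 'a \<Rightarrow> real" where m: "Metric_space UNIV d"
    and top: "Metric_space.mtopology UNIV d = euclidean"
    and compl: "Metric_space.mcomplete UNIV d"
    by (rule frechet_metric) (rule that; assumption)
  assume "\<nexists>n. interior (T n) \<noteq> {}"
  then have empty: "interior (T n) = {}" for n by blast
  have "Metric_space.mtopology UNIV d interior_of \<Union>(range T) = {}"
  proof (rule Metric_space.metric_Baire_category_alt[OF m compl])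
    fix S assume "S \<in> range T"
    then show "closedin (Metric_space.mtopology UNIV d) S \<and>
        Metric_space.mtopology UNIV d interior_of S = {}"
      using assms(1) empty unfolding top by force
  qed simp
  then have "interior (\<Union>(range T)) = {}" unfolding top by simp
  then show False using assms(2) by auto
qed

text \<open>
  The affine map \<open>u \<mapsto> (1 - t) *\<^sub>R a + t *\<^sub>R u\<close> sends \<open>W\<close> into itself and is continuous, hence it
  sends the closure into the closure.
\<close>

lemma convex_combination_closure:
  fixes W :: "'a::frechet_space set"
  assumes "convex W" "a \<in> W" "u \<in> closure W" "0 \<le> t" "t \<le> 1"
  shows "(1 - t) *\<^sub>R a + t *\<^sub>R u \<in> closure W"
proof -
  have "(\<lambda>u. (1 - t) *\<^sub>R a + t *\<^sub>R u) ` closure W \<subseteq> closure W"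
  proof (rule image_closure_subset)
    show "(\<lambda>u. (1 - t) *\<^sub>R a + t *\<^sub>R u) ` W \<subseteq> closure W"
      using assms closure_subset[of W] by (auto simp: convex_alt)
  qed (auto intro: continuous_on_affine)
  then show ?thesis using assms(3) by blast
qed

text \<open>
  Frechet spaces are barrelled.  The dilates of the closure cover the space, so by Baire's theorem
  one of them, and hence the closure, has an interior point \<open>w\<close>.  A small negative multiple of \<open>w\<close>
  lies in \<open>W\<close>, and \<open>0\<close> lies strictly between the two, which moves the interior point to \<open>0\<close>.
\<close>

lemma absorbing_closure_interior:
  fixes W :: "'a::frechet_space set"
  assumes W: "convex W" "absorbing W"
  shows "0 \<in> interior (closure W)"
proof -
  have 0: "0 \<in> W" using W(2) unfolding absorbing_def by (metis scaleR_zero_right)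
  define T where "T n = {x. 0 + (1 / real (Suc n)) *\<^sub>R x \<in> closure W}" for n
  have "x \<in> (\<Union>n. T n)" for x
  proof -
    obtain t where t: "t > 0" "t *\<^sub>R x \<in> W" using W(2) unfolding absorbing_def by blast
    obtain n where n: "1 / real (Suc n) < t" using t(1) nat_approx_posE by blast
    define s where "s = 1 / real (Suc n) / t"
    have s: "0 \<le> s" "s \<le> 1" "s * t = 1 / real (Suc n)"
      using n t(1) pos_divide_le_eq[OF t(1), of "1 / real (Suc n)" 1]
      by (simp_all only: s_def) auto
    have "(1 / real (Suc n)) *\<^sub>R x \<in> W"
      using convexD_alt[OF W(1) 0 t(2) s(1,2)] by (simp only: scaleR_scaleR s(3) scaleR_zero_right add_0_left)
    then show ?thesis using closure_subset unfolding T_def by auto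
  qed
  moreover have "closed (T n)" for n
    unfolding T_def by (rule closed_affine_preimage) simp
  ultimately obtain n where "interior (T n) \<noteq> {}" using frechet_Baire[of T] by blast
  then obtain p where p: "p \<in> interior (T n)" by blast
  define w where "w = (1 / real (Suc n)) *\<^sub>R p"
  obtain e where e: "e > 0" "e *\<^sub>R (- w) \<in> W" using W(2) unfolding absorbing_def by blast
  \<comment> \<open>This weight makes the combination of \<open>- e *\<^sub>R w\<close> and \<open>w\<close> vanish.\<close>
  define t where "t = e / (1 + e)"
  have t: "0 < t" "t < 1" "(1 - t) * e = t" using e(1) by (auto simp: t_def field_simps)
  let ?O = "{u. p + (real (Suc n) / t) *\<^sub>R u \<in> interior (T n)}"
  show ?thesis
  proof (rule interiorI)
    show "open ?O" by (intro open_affine_preimage open_interior)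
    show "0 \<in> ?O" using p by simp
    show "?O \<subseteq> closure W"
    proof
      fix u assume "u \<in> ?O"
      then have "p + (real (Suc n) / t) *\<^sub>R u \<in> T n" using interior_subset by blast
      then have "w + (1 / t) *\<^sub>R u \<in> closure W"
        using t by (simp add: T_def w_def scaleR_add_right del: of_nat_Suc)
      from convex_combination_closure[OF W(1) e(2) this, of t]
      have "(1 - t) *\<^sub>R e *\<^sub>R (- w) + t *\<^sub>R (w + (1 / t) *\<^sub>R u) \<in> closure W"
        using t by simp
      moreover have "(1 - t) *\<^sub>R e *\<^sub>R (- w) = - (t *\<^sub>R w)" using t by simp
      ultimately show "u \<in> closure W" using t by (simp add: scaleR_add_right)
    qed
  qed
qed

section \<open>Differences of closed convex sets\<close>

lemma convex_minkowski_diff: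
  fixes A B :: "'a::real_vector set"
  assumes "convex A" "convex B"
  shows "convex (minkowski_diff A B)"
proof -
  have "minkowski_diff A B = (\<Union>x\<in>A. \<Union>y\<in>B. {x - y})" by (auto simp: minkowski_diff_def)
  then show ?thesis using convex_differences[OF assms] by simp
qed

text \<open>
  Shrinking a representation \<open>a - b\<close> towards \<open>0\<close> keeps both parts in their convex sets and
  eventually moves \<open>a\<close> into \<open>V\<close>.
\<close>

lemma absorbing_diff_localize:
  fixes A B :: "'a::frechet_space set"
  assumes A: "convex A" "0 \<in> A" and B: "convex B" "0 \<in> B"
    and V: "open V" "0 \<in> V" and D: "absorbing (minkowski_diff A B)"
  shows "absorbing (minkowski_diff (A \<inter> V) B)"
  unfolding absorbing_def
proof
  fix x
  obtain t a b where t: "t > 0" "t *\<^sub>R x = a - b" "a \<in> A" "b \<in> B"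
    using D unfolding absorbing_def minkowski_diff_def by blast
  have "\<forall>\<^sub>F s in at_right (0::real). s *\<^sub>R a \<in> V \<and> 0 < s \<and> s < 1"
    using eventually_scaled_in_nhd[OF V, of a]
    by (intro eventually_conj eventually_at_right_less eventually_at_right_real)
      (auto simp: eventually_at_right_field intro: exI[of _ 1])
  then obtain s :: real where s: "s *\<^sub>R a \<in> V" "0 < s" "s < 1"
    using eventually_happens' trivial_limit_at_right_real by blast
  have "s *\<^sub>R a \<in> A" "s *\<^sub>R b \<in> B"
    using convexD_alt[OF A(1) A(2) t(3), of s] convexD_alt[OF B(1) B(2) t(4), of s] s by auto
  moreover have "(s * t) *\<^sub>R x = s *\<^sub>R a - s *\<^sub>R b"
    using t(2) by (metis scaleR_scaleR scaleR_diff_right)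
  ultimately show "\<exists>t>0. t *\<^sub>R x \<in> minkowski_diff (A \<inter> V) B"
    using s t(1) unfolding minkowski_diff_def by (intro exI[of _ "s * t"]) auto
qed

text \<open>
  An open mapping theorem of Robinson--Ursescu type.  With the base \<open>V\<close> above, the closure of
  \<open>W n = (A \<inter> V n) - B\<close> is a neighbourhood of \<open>0\<close> for every \<open>n\<close>.  A point \<open>e\<close> of the closure of
  \<open>W 0\<close> is approximated by some \<open>x 0 - z 0\<close> in \<open>W 0\<close> so well that twice the error lies in the closure
  of \<open>W 1\<close>; repeating this yields \<open>x n \<in> A \<inter> V n\<close> and \<open>z n \<in> B\<close> for which the sum of the terms
  \<open>(1/2)^n *\<^sub>R (x n - z n)\<close> is \<open>e\<close>.  Halved, the coefficients sum to \<open>1\<close>, so that by convexity and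
  closedness the limits lie in \<open>A\<close> and in \<open>B\<close>, and \<open>(1/2) *\<^sub>R e \<in> A - B\<close>.  Only the \<open>A\<close>-parts
  have to be localized: their sum converges by completeness, and the sum of the \<open>B\<close>-parts then
  converges as a difference.
\<close>

lemma absorbing_diff_imp_zero_interior:
  fixes A B :: "'a::frechet_space set"
  assumes A: "convex A" "closed A" "0 \<in> A" and B: "convex B" "closed B" "0 \<in> B"
    and D: "absorbing (minkowski_diff A B)"
  shows "0 \<in> interior (minkowski_diff A B)"
proof -
  obtain V :: "nat \<Rightarrow> 'a set"
    where V: "\<And>n. open (V n)" "\<And>n. convex (V n)" "\<And>n. 0 \<in> V n"
      and small: "\<And>U. open U \<Longrightarrow> 0 \<in> U \<Longrightarrow> \<forall>\<^sub>F n in sequentially. V n \<subseteq> U"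
      and conv: "\<And>x. (\<And>n. x (Suc n) - x n \<in> V n) \<Longrightarrow> convergent x"
    using frechet_convex_base by metis
  have shrink: "s *\<^sub>R v \<in> V n" if "v \<in> V n" "0 \<le> s" "s \<le> 1" for s v n
    using convexD_alt[OF V(2) V(3) that] by simp
  define W where "W n = minkowski_diff (A \<inter> V n) B" for n
  define N where "N n = interior (closure (W n)) \<inter> V n" for n
  have W0: "0 \<in> interior (closure (W n))" for n
    unfolding W_def using A B D V
    by (intro absorbing_closure_interior convex_minkowski_diff convex_Int absorbing_diff_localize)
  have half: "(1/2) *\<^sub>R e \<in> minkowski_diff A B" if e: "e \<in> closure (W 0)" for e
  proof -
    \<comment> \<open>\<open>r\<close> is the error before step \<open>n\<close>, rescaled by \<open>2^n\<close>; membership in \<open>V n\<close> makes the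
      unscaled error tend to \<open>0\<close>.\<close>
    define P where "P n r \<longleftrightarrow> r \<in> closure (W n) \<and> (n = 0 \<longrightarrow> r = e) \<and> (n > 0 \<longrightarrow> r \<in> V n)"
      for n :: nat and r
    define Q where "Q n r r' \<longleftrightarrow> (\<exists>x z. x \<in> A \<inter> V n \<and> z \<in> B \<and> r' = 2 *\<^sub>R (r - (x - z)))"
      for n :: nat and r r'
    have "\<exists>r. \<forall>n. P n (r n) \<and> Q n (r n) (r (Suc n))"
    proof (rule dependent_nat_choice)
      show "\<exists>r. P 0 r" using e by (auto simp: P_def)
    next
      fix r n assume "P n r"
      then have r: "r \<in> closure (W n)" by (simp add: P_def)
      let ?O = "{y. 2 *\<^sub>R r + (- 2) *\<^sub>R y \<in> N (Suc n)}"
      have "open ?O" using V(1) by (intro open_affine_preimage) (simp add: N_def open_Int)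
      moreover have "r \<in> ?O" using W0 V(3) by (simp add: N_def)
      ultimately have "W n \<inter> ?O \<noteq> {}" using r by (metis open_Int_closure_eq_empty IntI empty_iff inf_commute)
      then obtain y where y: "y \<in> W n" "2 *\<^sub>R r + (- 2) *\<^sub>R y \<in> N (Suc n)" by blast
      obtain x z where "x \<in> A \<inter> V n" "z \<in> B" "y = x - z"
        using y(1) unfolding W_def minkowski_diff_def by blast
      moreover from this have "2 *\<^sub>R r + (- 2) *\<^sub>R y = 2 *\<^sub>R (r - (x - z))"
        by (simp add: scaleR_diff_right)
      ultimately have "Q n r (2 *\<^sub>R r + (- 2) *\<^sub>R y)"
        unfolding Q_def by blast
      moreover have "P (Suc n) (2 *\<^sub>R r + (- 2) *\<^sub>R y)"
        using y(2) interior_subset by (auto simp: P_def N_def)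
      ultimately show "\<exists>r'. P (Suc n) r' \<and> Q n r r'" by blast
    qed
    then obtain r where r: "\<And>n. P n (r n)" "\<And>n. Q n (r n) (r (Suc n))" by blast
    obtain x z where x: "\<And>n. x n \<in> A \<inter> V n" and z: "\<And>n. z n \<in> B"
      and r': "\<And>n. r (Suc n) = 2 *\<^sub>R (r n - (x n - z n))"
      using r(2) unfolding Q_def by metis
    define X where "X n = (\<Sum>k<n. (1/2)^(Suc k) *\<^sub>R x k)" for n
    define Z where "Z n = (\<Sum>k<n. (1/2)^(Suc k) *\<^sub>R z k)" for n
    \<comment> \<open>The dyadic weights of the first \<open>n\<close> points leave the weight \<open>(1/2)^n\<close>, which is given to
      \<open>c\<close>; taking \<open>c = 0\<close> puts the partial sums into \<open>A\<close> and \<open>B\<close>.\<close>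
    have partial: "(\<Sum>k<n. (1/2)^(Suc k) *\<^sub>R y k) + (1/2)^n *\<^sub>R c \<in> C"
      if C: "convex C" and y: "\<And>k. y k \<in> C" and c: "c \<in> C"
      for C :: "'a set" and y :: "nat \<Rightarrow> 'a" and c n
      using c
    proof (induction n arbitrary: c)
      case (Suc n)
      have "(1/2) *\<^sub>R y n + (1/2) *\<^sub>R c \<in> C"
        using C y Suc.prems by (intro convexD) auto
      from Suc.IH[OF this] show ?case by (simp add: algebra_simps)
    qed simp
    have XA: "X n \<in> A" for n
      using partial[of A x 0 n] A x unfolding X_def by simp
    have ZB: "Z n \<in> B" for n
      using partial[of B z 0 n] B z unfolding Z_def by simp
    have diff: "Z n = X n - (1/2) *\<^sub>R e + (1/2)^(Suc n) *\<^sub>R r n" for n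
    proof (induction n)
      case 0
      then show ?case using r(1)[of 0] by (simp add: X_def Z_def P_def)
    next
      case (Suc n)
      have "(1/2)^(Suc (Suc n)) *\<^sub>R r (Suc n) = (1/2)^(Suc n) *\<^sub>R (r n - x n + z n)"
        unfolding r' by (simp add: algebra_simps)
      moreover have "X (Suc n) = X n + (1/2)^(Suc n) *\<^sub>R x n" "Z (Suc n) = Z n + (1/2)^(Suc n) *\<^sub>R z n"
        by (simp_all add: X_def Z_def)
      ultimately show ?case using Suc by (simp add: algebra_simps)
    qed
    have "X (Suc n) - X n \<in> V n" for n
    proof -
      have "X (Suc n) - X n = (1/2)^(Suc n) *\<^sub>R x n" by (simp add: X_def)
      also have "\<dots> \<in> V n" using x[of n] by (intro shrink power_le_one) auto
      finally show ?thesis .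
    qed
    from conv[OF this] obtain l where l: "X \<longlonglongrightarrow> l" unfolding convergent_def by blast
    have "(\<lambda>n. (1/2)^(Suc n) *\<^sub>R r n) \<longlonglongrightarrow> 0"
    proof (rule topological_tendstoI)
      fix U :: "'a set" assume "open U" "0 \<in> U"
      from small[OF this] eventually_gt_at_top[of 0]
      show "\<forall>\<^sub>F n in sequentially. (1/2)^(Suc n) *\<^sub>R r n \<in> U"
      proof eventually_elim
        case (elim n)
        have "(1/2)^(Suc n) *\<^sub>R r n \<in> V n"
          using r(1)[of n] elim by (intro shrink power_le_one) (auto simp: P_def)
        then show ?case using elim by blast
      qed
    qed
    then have "(\<lambda>n. X n - (1/2) *\<^sub>R e + (1/2)^(Suc n) *\<^sub>R r n) \<longlonglongrightarrow> l - (1/2) *\<^sub>R e + 0"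
      unfolding diff_conv_add_uminus by (intro tendsto_add l tendsto_const)
    then have lZ: "Z \<longlonglongrightarrow> l - (1/2) *\<^sub>R e" unfolding diff[symmetric] by simp
    have "l - (1/2) *\<^sub>R e \<in> B"
      by (rule Lim_in_closed_set[OF B(2) _ _ lZ]) (simp_all add: ZB)
    moreover have "l \<in> A"
      by (rule Lim_in_closed_set[OF A(2) _ _ l]) (simp_all add: XA)
    moreover have "(1/2) *\<^sub>R e = l - (l - (1/2) *\<^sub>R e)" by simp
    ultimately show ?thesis unfolding minkowski_diff_def mem_Collect_eq by (intro exI conjI)
  qed
  show ?thesis
  proof (rule interiorI)
    show "open {u. 0 + 2 *\<^sub>R u \<in> interior (closure (W 0))}"
      by (intro open_affine_preimage open_interior)
    show "0 \<in> {u. 0 + 2 *\<^sub>R u \<in> interior (closure (W 0))}" using W0 by simp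
    show "{u. 0 + 2 *\<^sub>R u \<in> interior (closure (W 0))} \<subseteq> minkowski_diff A B"
      using half interior_subset[of "closure (W 0)"] by force
  qed
qed

section \<open>Convex functions\<close>

lemma convex_fun_le:
  assumes h: "convex_fun h" and x: "h x \<le> ereal a" and y: "h y \<le> ereal b"
    and t: "0 \<le> t" "t \<le> 1"
  shows "h ((1 - t) *\<^sub>R x + t *\<^sub>R y) \<le> ereal ((1 - t) * a + t * b)"
proof -
  consider "t = 0" | "t = 1" | "0 < t" "t < 1" using t by linarith
  then show ?thesis
  proof cases
    case 3
    then have "h ((1 - t) *\<^sub>R x + t *\<^sub>R y) \<le> ereal (1 - t) * h x + ereal t * h y"
      using h by (simp add: convex_fun_def)
    also have "\<dots> \<le> ereal (1 - t) * ereal a + ereal t * ereal b"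
      using 3 x y by (intro add_mono ereal_mult_left_mono) auto
    finally show ?thesis by simp
  qed (use x y in auto)
qed

lemma convex_sublevel:
  assumes "convex_fun h"
  shows "convex {x. h x \<le> ereal r}"
  unfolding convex_alt using convex_fun_le[OF assms, of _ r _ r] by (auto simp: algebra_simps)

lemma closed_sublevel:
  assumes "lsc_fun h"
  shows "closed {x. h x \<le> ereal r}"
proof -
  have "\<exists>T. open T \<and> x \<in> T \<and> T \<subseteq> - {x. h x \<le> ereal r}" if "\<not> h x \<le> ereal r" for x
  proof -
    have "ereal r < Liminf (at x) h"
      using that assms unfolding lsc_fun_def by (meson less_le_trans not_le)
    then have "\<forall>\<^sub>F y in at x. ereal r < h y" by (rule less_LiminfD)
    then have "\<forall>\<^sub>F y in nhds x. ereal r < h y"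
      using that by (auto simp: eventually_at_filter elim: eventually_mono)
    then show ?thesis unfolding eventually_nhds by force
  qed
  then show ?thesis unfolding closed_def by (subst open_subopen) auto
qed

lemma eventually_sublevel_towards:
  assumes h: "convex_fun h" and p: "h p < ereal R" and x: "x \<in> edom h"
  shows "\<forall>\<^sub>F s in at_right (0::real). h (p + s *\<^sub>R (x - p)) \<le> ereal R"
proof -
  obtain a where a: "h p \<le> ereal a" "a < R"
    using p by (metis ereal_dense2 ereal_less_eq(3) less_ereal.simps(1) less_imp_le)
  obtain b where b: "h x \<le> ereal b"
    using x unfolding edom_def by (auto dest!: less_PInf_Ex_of_nat[THEN iffD1] less_imp_le)
  have "((\<lambda>s. (1 - s) * a + s * b) \<longlongrightarrow> (1 - 0) * a + 0 * b) (at_right (0::real))"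
    by (intro tendsto_intros)
  then have "\<forall>\<^sub>F s in at_right 0. (1 - s) * a + s * b < R"
    using a(2) by (auto dest: order_tendstoD)
  moreover have "\<forall>\<^sub>F s in at_right (0::real). 0 < s \<and> s < 1"
    by (auto simp: eventually_at_right_field intro: exI[of _ 1])
  ultimately show ?thesis
  proof eventually_elim
    case (elim s)
    have "p + s *\<^sub>R (x - p) = (1 - s) *\<^sub>R p + s *\<^sub>R x" by (simp add: algebra_simps)
    then have "h (p + s *\<^sub>R (x - p)) \<le> ereal ((1 - s) * a + s * b)"
      using convex_fun_le[OF h a(1) b, of s] elim by simp
    also have "\<dots> \<le> ereal R" using elim by simp
    finally show ?case .
  qed
qed

text \<open>
  A positive multiple of any point is \<open>a - b\<close> with \<open>a \<in> edom f\<close> and \<open>b \<in> edom g\<close>.  Contracting both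
  \<open>a\<close> and \<open>b\<close> towards \<open>p\<close> brings them below the level \<open>R\<close> and only rescales the difference.
  Translating by \<open>p\<close> gives sets that contain \<open>0\<close>, as \<open>absorbing_diff_imp_zero_interior\<close> requires.
\<close>

lemma zero_in_interior_sublevel_diff:
  fixes f g :: "'a::frechet_space \<Rightarrow> ereal"
  assumes f: "convex_fun f" "lsc_fun f" "f p < ereal R"
    and g: "convex_fun g" "lsc_fun g" "g p < ereal R"
    and D: "absorbing (minkowski_diff (edom f) (edom g))"
  shows "0 \<in> interior (minkowski_diff {x. f x \<le> ereal R} {x. g x \<le> ereal R})"
proof -
  let ?A = "{x. p + 1 *\<^sub>R x \<in> {x. f x \<le> ereal R}}"
  let ?B = "{x. p + 1 *\<^sub>R x \<in> {x. g x \<le> ereal R}}"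
  have shift: "convex {x. p + 1 *\<^sub>R x \<in> C}" if "convex C" for C
  proof -
    have "{x. p + 1 *\<^sub>R x \<in> C} = (+) (- p) ` C" by (auto simp: image_iff algebra_simps)
    then show ?thesis using convex_translation[OF that] by metis
  qed
  have "absorbing (minkowski_diff ?A ?B)"
    unfolding absorbing_def
  proof
    fix y
    obtain t a b where t: "t > 0" "t *\<^sub>R y = a - b" "a \<in> edom f" "b \<in> edom g"
      using D unfolding absorbing_def minkowski_diff_def by blast
    have "\<forall>\<^sub>F s in at_right (0::real). f (p + s *\<^sub>R (a - p)) \<le> ereal R \<and>
            g (p + s *\<^sub>R (b - p)) \<le> ereal R \<and> s > 0"
      using f g t by (intro eventually_conj eventually_sublevel_towards eventually_at_right_less)
    then obtain s :: real where s: "f (p + s *\<^sub>R (a - p)) \<le> ereal R"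
        "g (p + s *\<^sub>R (b - p)) \<le> ereal R" "s > 0"
      using eventually_happens' trivial_limit_at_right_real by blast
    have "(s * t) *\<^sub>R y = s *\<^sub>R (a - p) - s *\<^sub>R (b - p)"
      using t(2) by (metis scaleR_scaleR scaleR_diff_right diff_diff_eq2 diff_add_cancel)
    then show "\<exists>t>0. t *\<^sub>R y \<in> minkowski_diff ?A ?B"
      using s t(1) unfolding minkowski_diff_def by (intro exI[of _ "s * t"]) auto
  qed
  then have "0 \<in> interior (minkowski_diff ?A ?B)"
    using f g
    by (intro absorbing_diff_imp_zero_interior shift convex_sublevel closed_affine_preimage closed_sublevel)
      (auto simp: less_imp_le)
  moreover have "minkowski_diff ?A ?B \<subseteq> minkowski_diff {x. f x \<le> ereal R} {x. g x \<le> ereal R}"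
  proof
    fix u assume "u \<in> minkowski_diff ?A ?B"
    then obtain a b where "u = a - b" "f (p + a) \<le> ereal R" "g (p + b) \<le> ereal R"
      by (auto simp: minkowski_diff_def)
    moreover from this have "u = (p + a) - (p + b)" by simp
    ultimately show "u \<in> minkowski_diff {x. f x \<le> ereal R} {x. g x \<le> ereal R}"
      unfolding minkowski_diff_def by blast
  qed
  ultimately show ?thesis using interior_mono by blast
qed

section \<open>The epigraphical difference set\<close>

text \<open>
  Up to vertical limits, \<open>E_F f g\<close> is thus the epigraph of the perturbation function minus the optimal
  value; bounds instead of function values avoid arithmetic with infinities.
\<close>

lemma mem_E_F_iff:
  assumes v: "v_PF f g = ereal v"
  shows "(y, r) \<in> E_F f g \<longleftrightarrow>
    (\<exists>x z a b. y = x - z \<and> f x \<le> ereal a \<and> g z \<le> ereal b \<and> r = a + b - v)"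
proof -
  have *: "g z - ereal v \<le> ereal (- s) \<longleftrightarrow> g z \<le> ereal (v - s)" for z s
    by (cases "g z") auto
  have "(y, r) \<in> E_F f g \<longleftrightarrow>
    (\<exists>x z a s. y = x - z \<and> f x \<le> ereal a \<and> g z \<le> ereal (v - s) \<and> r = a - s)"
    unfolding E_F_def minkowski_diff_def epi_def epi_hat_def v by (auto simp: *)
  also have "\<dots> \<longleftrightarrow> (\<exists>x z a b. y = x - z \<and> f x \<le> ereal a \<and> g z \<le> ereal b \<and> r = a + b - v)"
    (is "?L \<longleftrightarrow> ?R")
  proof
    assume ?L
    then obtain x z a s where "y = x - z" "f x \<le> ereal a" "g z \<le> ereal (v - s)" "r = a - s"
      by blast
    then show ?R by (intro exI[of _ x] exI[of _ z] exI[of _ a] exI[of _ "v - s"]) auto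
  next
    assume ?R
    then obtain x z a b where "y = x - z" "f x \<le> ereal a" "g z \<le> ereal b" "r = a + b - v"
      by blast
    then show ?L by (intro exI[of _ x] exI[of _ z] exI[of _ a] exI[of _ "v - b"]) auto
  qed
  finally show ?thesis .
qed

lemma convex_E_F:
  assumes "convex_fun f" "convex_fun g" and v: "v_PF f g = ereal v"
  shows "convex (E_F f g)"
  unfolding convex_alt
proof (intro ballI allI impI)
  fix p q and t :: real
  assume p: "p \<in> E_F f g" and q: "q \<in> E_F f g" and t: "0 \<le> t \<and> t \<le> 1"
  obtain y r y' r' where pq: "p = (y, r)" "q = (y', r')" by fastforce
  obtain x z a b where 1: "y = x - z" "f x \<le> ereal a" "g z \<le> ereal b" "r = a + b - v"
    using p unfolding pq mem_E_F_iff[OF v] by blast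
  obtain x' z' a' b' where 2: "y' = x' - z'" "f x' \<le> ereal a'" "g z' \<le> ereal b'" "r' = a' + b' - v"
    using q unfolding pq mem_E_F_iff[OF v] by blast
  have "((1 - t) *\<^sub>R y + t *\<^sub>R y', (1 - t) * r + t * r') \<in> E_F f g"
    unfolding mem_E_F_iff[OF v]
    by (rule exI[of _ "(1 - t) *\<^sub>R x + t *\<^sub>R x'"], rule exI[of _ "(1 - t) *\<^sub>R z + t *\<^sub>R z'"],
        rule exI[of _ "(1 - t) * a + t * a'"], rule exI[of _ "(1 - t) * b + t * b'"])
      (use convex_fun_le[OF assms(1) 1(2) 2(2), of t] convex_fun_le[OF assms(2) 1(3) 2(3), of t] t
        in \<open>simp add: 1(1,4) 2(1,4) algebra_simps\<close>)
  then show "(1 - t) *\<^sub>R p + t *\<^sub>R q \<in> E_F f g" by (simp add: pq)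
qed

lemma E_F_over_zero_nonneg:
  assumes v: "v_PF f g = ereal v" and "(0, r) \<in> E_F f g"
  shows "0 \<le> r"
proof -
  obtain x a b where x: "f x \<le> ereal a" "g x \<le> ereal b" "r = a + b - v"
    using assms(2) unfolding mem_E_F_iff[OF v] by auto
  have "ereal v \<le> f x + g x" unfolding v[symmetric] v_PF_def by (rule INF_lower) simp
  also have "\<dots> \<le> ereal a + ereal b" using x by (intro add_mono)
  finally show ?thesis using x by simp
qed

lemma positive_axis_in_E_F:
  assumes "proper_fun f" "proper_fun g" and v: "v_PF f g = ereal v" and "e > 0"
  shows "(0, e) \<in> E_F f g"
proof -
  have "(INF x. f x + g x) < ereal (v + e)" using v \<open>e > 0\<close> by (simp add: v_PF_def)
  then obtain x where x: "f x + g x < ereal (v + e)" by (auto simp: INF_less_iff)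
  have "f x > -\<infinity>" "g x > -\<infinity>" using assms by (auto simp: proper_fun_def)
  then obtain a b where "f x = ereal a" "g x = ereal b"
    using x by (cases "f x"; cases "g x") auto
  then show ?thesis
    using x unfolding mem_E_F_iff[OF v]
    by (intro exI[of _ x] exI[of _ a] exI[of _ "v + e - a"]) auto
qed

text \<open>
  If the infimum is not attained, \<open>(0, 0)\<close> is missing from \<open>E_F f g\<close>, but every point above it is
  present.  Allowing an arbitrarily small vertical shift turns \<open>E_F f g\<close> into a larger convex set
  that contains the origin, hence the whole hull.
\<close>

lemma hull_E_F_approx:
  assumes "proper_fun f" "convex_fun f" "proper_fun g" "convex_fun g" and v: "v_PF f g = ereal v"
    and p: "(y, r) \<in> convex hull (E_F f g \<union> {(0, 0)})" and "e > 0"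
  shows "(y, r + e) \<in> E_F f g"
proof -
  let ?H = "{(y, r). \<forall>e>0. (y, r + e) \<in> E_F f g}"
  have "convex ?H"
    unfolding convex_alt
  proof (clarsimp, goal_cases)
    case (1 y r y' r' t e)
    have "(1 - t) *\<^sub>R (y, r + e) + t *\<^sub>R (y', r' + e) \<in> E_F f g"
      using convexD_alt[OF convex_E_F[OF assms(2,4) v], of "(y, r + e)" "(y', r' + e)" t] 1 by simp
    then show ?case by (simp add: algebra_simps)
  qed
  moreover have "(y, r + e) \<in> E_F f g" if "(y, r) \<in> E_F f g" "e > 0" for y r e
  proof -
    obtain x z a b where "y = x - z" "f x \<le> ereal a" "g z \<le> ereal b" "r = a + b - v"
      using \<open>(y, r) \<in> E_F f g\<close> unfolding mem_E_F_iff[OF v] by blast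
    then show ?thesis
      unfolding mem_E_F_iff[OF v] using \<open>e > 0\<close>
      by (intro exI[of _ x] exI[of _ z] exI[of _ "a + e"] exI[of _ b])
        (auto intro: order_trans)
  qed
  ultimately have "convex hull (E_F f g \<union> {(0, 0)}) \<subseteq> ?H"
    using positive_axis_in_E_F[OF assms(1,3) v] by (intro hull_minimal) auto
  then show ?thesis using p \<open>e > 0\<close> by blast
qed

text \<open>
  Suppose that \<open>(y, r)\<close> lies in the hull and \<open>t *\<^sub>R (y, r)\<close> is close to \<open>(0, -1)\<close>.  The point
  \<open>- (t / \<delta>) *\<^sub>R y\<close>, opposite to \<open>y\<close>, is then in the neighbourhood where the perturbation function
  is at most \<open>M\<close>.  The segment between the two corresponding points of the epigraph crosses the
  vertical axis at a height which is nonnegative, as the optimal value has been subtracted.  This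
  reads \<open>- \<delta> * M \<le> t * r\<close>, and \<open>\<delta> * M = 1/2\<close> contradicts \<open>t * r\<close> being close to \<open>-1\<close>.
\<close>

lemma zero_notin_qri_hull:
  fixes f g :: "'a::frechet_space \<Rightarrow> ereal"
  assumes fg: "proper_fun f" "convex_fun f" "proper_fun g" "convex_fun g"
    and v: "v_PF f g = ereal v"
    and N: "0 \<in> interior (minkowski_diff {x. f x \<le> ereal R} {x. g x \<le> ereal R})"
      (is "0 \<in> interior ?D")
  shows "(0, 0) \<notin> qri (convex hull (E_F f g \<union> {(0, 0)}))"
proof
  let ?C = "convex hull (E_F f g \<union> {(0, 0)})"
  assume "(0, 0) \<in> qri ?C"
  then have "subspace (closure (gen_cone ((\<lambda>x. x - (0, 0)) ` ?C)))"
    unfolding qri_def by blast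
  then have sub: "subspace (closure (gen_cone ?C))" by (simp flip: zero_prod_def)
  have "(0, 1) \<in> ?C"
    using positive_axis_in_E_F[OF fg(1,3) v, of 1] by (auto intro: hull_inc)
  then have "(0, 1) \<in> gen_cone ?C"
    unfolding gen_cone_def by (intro UN_I[of 1] image_eqI[of _ _ "(0, 1)"]) auto
  then have "(0, 1) \<in> closure (gen_cone ?C)" using closure_subset by blast
  from subspace_neg[OF sub this] have neg: "(0, - 1) \<in> closure (gen_cone ?C)" by simp
  define M where "M = max 1 (2 * R - v)"
  define \<delta> where "\<delta> = 1 / (2 * M)"
  have M: "M > 0" "\<delta> > 0" "\<delta> * M = 1/2" by (auto simp: M_def \<delta>_def)
  have bound: "(u, M) \<in> E_F f g" if u: "u \<in> ?D" for u
  proof -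
    obtain x z where "u = x - z" "f x \<le> ereal R" "g z \<le> ereal R"
      using u unfolding minkowski_diff_def by blast
    moreover have "R \<le> M + v - R" by (simp add: M_def)
    ultimately show ?thesis
      unfolding mem_E_F_iff[OF v]
      by (intro exI[of _ x] exI[of _ z] exI[of _ R] exI[of _ "M + v - R"])
        (auto intro: order_trans)
  qed
  let ?O = "{u. 0 + (- 1 / \<delta>) *\<^sub>R u \<in> interior ?D} \<times> {..< - 1/2::real}"
  have "open ?O" by (intro open_Times open_affine_preimage open_interior open_lessThan)
  moreover have "(0, - 1) \<in> ?O" using N by simp
  ultimately have "gen_cone ?C \<inter> ?O \<noteq> {}"
    using neg by (metis open_Int_closure_eq_empty IntI empty_iff inf_commute)
  then obtain t y r where yr: "(y, r) \<in> ?C" and t: "t \<ge> 0"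
    and O: "(t *\<^sub>R y, t *\<^sub>R r) \<in> ?O"
    unfolding gen_cone_def by fastforce
  let ?u = "(- 1 / \<delta>) *\<^sub>R t *\<^sub>R y"
  have u: "(?u, M) \<in> E_F f g" using O interior_subset by (intro bound) auto
  have tr: "t * r < - 1/2" using O by simp
  \<comment> \<open>The weight for which the segment from \<open>?u\<close> to \<open>y\<close> passes through \<open>0\<close>.\<close>
  define s where "s = t / (t + \<delta>)"
  have s: "0 \<le> s" "s \<le> 1" "1 - s = \<delta> / (t + \<delta>)" using t M by (auto simp: s_def field_simps)
  have ge: "0 \<le> (1 - s) * M + s * (r + e)" if e: "e > 0" for e
  proof -
    have "(1 - s) *\<^sub>R (?u, M) + s *\<^sub>R (y, r + e) \<in> E_F f g"
      using convexD_alt[OF convex_E_F[OF fg(2,4) v] u hull_E_F_approx[OF fg v yr e] s(1,2)] .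
    moreover have "(1 - s) *\<^sub>R ?u + s *\<^sub>R y = 0"
      using M t unfolding s(3) by (simp add: s_def)
    ultimately have "(0, (1 - s) * M + s * (r + e)) \<in> E_F f g"
      by (simp only: scaleR_Pair add_Pair real_scaleR_def)
    then show ?thesis by (rule E_F_over_zero_nonneg[OF v])
  qed
  have "0 \<le> \<delta> * M + t * (r + e)" if e: "e > 0" for e
  proof -
    have "0 \<le> (t + \<delta>) * ((1 - s) * M + s * (r + e))" using ge[OF e] t M by simp
    also have "\<dots> = \<delta> * M + t * (r + e)"
      using t M unfolding s(3) by (simp add: s_def distrib_left)
    finally show ?thesis .
  qed
  then have *: "- (1/2) - t * r \<le> t * e" if "e > 0" for e
    using that M(3) by (fastforce simp: distrib_left)
  have "t > 0" using tr t by (cases "t = 0") auto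
  define e where "e = (- (1/2) - t * r) / (2 * t)"
  have "e > 0" "2 * (t * e) = - (1/2) - t * r" using \<open>t > 0\<close> tr by (simp_all add: e_def)
  then show False using *[of e] tr by linarith
qed

section \<open>The regularity conditions\<close>

lemma edom_nhd_of_isCont:
  assumes "isCont h x" "x \<in> edom h"
  shows "\<forall>\<^sub>F y in nhds x. y \<in> edom h"
proof -
  have "\<forall>\<^sub>F y in at x. h y < \<infinity>"
    using assms unfolding isCont_def edom_def by (auto dest: order_tendstoD)
  then show ?thesis using assms(2) by (auto simp: edom_def eventually_at_filter elim: eventually_mono)
qed

lemma RC1_imp_RC2:
  fixes f g :: "'a::frechet_space \<Rightarrow> ereal"
  assumes "RC1 f g"
  shows "RC2 f g"
proof -
  obtain x where x: "x \<in> edom f" "x \<in> edom g" "isCont f x \<or> isCont g x"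
    using assms unfolding RC1_def by blast
  from x(3) show ?thesis
  proof
    assume "isCont f x"
    then obtain U where U: "open U" "x \<in> U" "U \<subseteq> edom f"
      using edom_nhd_of_isCont[of x f] x unfolding eventually_nhds by blast
    show ?thesis
      unfolding RC2_def
    proof (rule interiorI)
      show "open {u. x + 1 *\<^sub>R u \<in> U}" using U(1) by (rule open_affine_preimage)
      have "u \<in> minkowski_diff (edom f) (edom g)" if "x + u \<in> U" for u
        unfolding minkowski_diff_def mem_Collect_eq
        by (rule exI[of _ "x + u"], rule exI[of _ x]) (use that U x in auto)
      then show "{u. x + 1 *\<^sub>R u \<in> U} \<subseteq> minkowski_diff (edom f) (edom g)" by auto
    qed (use U in auto)
  next
    assume "isCont g x"
    then obtain U where U: "open U" "x \<in> U" "U \<subseteq> edom g"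
      using edom_nhd_of_isCont[of x g] x unfolding eventually_nhds by blast
    show ?thesis
      unfolding RC2_def
    proof (rule interiorI)
      show "open {u. x + (- 1) *\<^sub>R u \<in> U}" using U(1) by (rule open_affine_preimage)
      have "u \<in> minkowski_diff (edom f) (edom g)" if "x - u \<in> U" for u
        unfolding minkowski_diff_def mem_Collect_eq
        by (rule exI[of _ x], rule exI[of _ "x - u"]) (use that U x in auto)
      then show "{u. x + (- 1) *\<^sub>R u \<in> U} \<subseteq> minkowski_diff (edom f) (edom g)" by auto
    qed (use U in auto)
  qed
qed

lemma zero_in_core_imp_qi: "0 \<in> core S \<Longrightarrow> 0 \<in> qi S"
  by (simp add: core_def qi_def)

lemma gen_cone_mono: "S \<subseteq> T \<Longrightarrow> gen_cone S \<subseteq> gen_cone T"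
  unfolding gen_cone_def by blast

text \<open>
  From right to left: the closed cone of \<open>S\<close>, being a linear subspace that contains \<open>S\<close>, contains
  the cone of \<open>S - S\<close>, whose closure is everything.
\<close>

lemma zero_in_qi_iff:
  fixes S :: "'a::{real_vector, topological_space} set"
  assumes "0 \<in> S"
  shows "0 \<in> qi S \<longleftrightarrow> 0 \<in> qi (minkowski_diff S S) \<and> 0 \<in> qri S"
proof
  assume "0 \<in> qi S"
  then have *: "closure (gen_cone S) = UNIV" by (simp add: qi_def)
  have "S \<subseteq> minkowski_diff S S" using assms unfolding minkowski_diff_def by force
  then have "closure (gen_cone S) \<subseteq> closure (gen_cone (minkowski_diff S S))"
    by (intro closure_mono gen_cone_mono)
  moreover have "0 \<in> minkowski_diff S S" using assms unfolding minkowski_diff_def by force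
  ultimately show "0 \<in> qi (minkowski_diff S S) \<and> 0 \<in> qri S"
    using * assms by (auto simp: qi_def qri_def)
next
  assume R: "0 \<in> qi (minkowski_diff S S) \<and> 0 \<in> qri S"
  let ?L = "closure (gen_cone S)"
  have L: "subspace ?L" and top: "closure (gen_cone (minkowski_diff S S)) = UNIV"
    using R by (auto simp: qi_def qri_def)
  have "S \<subseteq> gen_cone S" unfolding gen_cone_def by (force intro: bexI[of _ 1])
  then have "S \<subseteq> ?L" using closure_subset by blast
  then have "t *\<^sub>R (a - b) \<in> ?L" if "a \<in> S" "b \<in> S" for t a b
    using that by (intro subspace_scale[OF L] subspace_diff[OF L]) auto
  then have "gen_cone (minkowski_diff S S) \<subseteq> ?L"
    unfolding gen_cone_def[of "minkowski_diff S S"] unfolding minkowski_diff_def by blast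
  then have "closure (gen_cone (minkowski_diff S S)) \<subseteq> ?L" by (intro closure_minimal) auto
  then show "0 \<in> qi S" using top assms by (auto simp: qi_def)
qed

theorem proposition20:
  fixes f g :: "'a::frechet_space \<Rightarrow> ereal"
  assumes "proper_fun f" and "convex_fun f" and "lsc_fun f"
    and "proper_fun g" and "convex_fun g" and "lsc_fun g"
    and "edom f \<inter> edom g \<noteq> {}"
    and "\<exists>v::real. v_PF f g = ereal v"
  shows "(RC1 f g \<longrightarrow> RC2 f g) \<and> (RC2 f g \<longleftrightarrow> RC3 f g) \<and>
         (RC3 f g \<longrightarrow> RC6 f g) \<and> (RC6 f g \<longleftrightarrow> RC7 f g)"
proof -
  let ?D = "minkowski_diff (edom f) (edom g)"
  obtain v where v: "v_PF f g = ereal v" using assms(8) by blast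
  obtain p where p: "p \<in> edom f" "p \<in> edom g" using assms(7) by blast
  then have "max (f p) (g p) < \<infinity>" by (simp add: edom_def max_def)
  then obtain n :: nat where "max (f p) (g p) < ereal (real n)"
    using less_PInf_Ex_of_nat by auto
  then obtain R where R: "f p < ereal R" "g p < ereal R" by auto
  let ?A = "{x. f x \<le> ereal R}" and ?B = "{x. g x \<le> ereal R}"
  have sublevel: "0 \<in> interior (minkowski_diff ?A ?B)" if "RC3 f g"
    using zero_in_interior_sublevel_diff[OF assms(2,3) R(1) assms(5,6) R(2)] that
    by (simp add: RC3_def zero_in_core_iff_absorbing)
  have "minkowski_diff ?A ?B \<subseteq> ?D"
    unfolding minkowski_diff_def edom_def by (force intro: le_less_trans)
  then have 32: "RC3 f g \<Longrightarrow> RC2 f g"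
    using sublevel interior_mono unfolding RC2_def by blast
  have 23: "RC2 f g \<Longrightarrow> RC3 f g"
    unfolding RC2_def RC3_def zero_in_core_iff_absorbing by (rule absorbing_of_interior)
  have 36: "RC3 f g \<Longrightarrow> RC6 f g"
    using zero_notin_qri_hull[OF assms(1,2,4,5) v sublevel] zero_in_core_imp_qi
    unfolding RC3_def RC6_def by blast
  have "0 \<in> ?D" using p unfolding minkowski_diff_def by force
  then have "RC6 f g \<longleftrightarrow> RC7 f g" unfolding RC6_def RC7_def by (simp add: zero_in_qi_iff)
  then show ?thesis using RC1_imp_RC2 32 23 36 by blast
qed

end
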